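(* Let $0<y<1$ be fixed, and for each integer $n\ge 1$ put $$G_n(y)=e^{-in/y}\,{}_3F_1\left(\begin{array}{c}-n,\ n,\ 1\\ 1/2\end{array}\,\Big|\,\frac{iy}{2n}\right).$$ Then, as $n\to\infty$ through even integers, $$\mathrm{Im}\,G_n(y)\sim-\left(\frac{n\pi y}{2\sqrt{1-y^2}}\right)^{1/2}\cos\left[n\left(\frac{\sqrt{1-y^2}}{y}+\sin^{-1}y\right)-\frac{\pi}{4}\right],$$ and, as $n\to\infty$ through odd integers, $$\mathrm{Re}\,G_n(y)\sim-\left(\frac{n\pi y}{2\sqrt{1-y^2}}\right)^{1/2}\sin\left[n\left(\frac{\sqrt{1-y^2}}{y}+\sin^{-1}y\right)-\frac{\pi}{4}\right].$$ For $-1<y<0$, with $G_n(y)$ defined by the same formula, the behavior is obtained by complex conjugation: $G_n(y)=\overline{G_n(-y)}$, where $0<-y<1$.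
   Context: For a positive integer $n$ and a complex number $w$, the terminating hypergeometric series (a polynomial in $w$) is $${}_3F_1\left(\begin{array}{c}-n,\ n,\ 1\\ 1/2\end{array}\,\Big|\,w\right)=\sum_{k=0}^{n}\frac{(-n)_k\,(n)_k\,(1)_k}{(1/2)_k\,k!}\,w^k,$$ where $(a)_0=1$ and $(a)_k=a(a+1)\cdots(a+k-1)$ is the Pochhammer symbol. $\sin^{-1}$ denotes the principal branch of the arcsine, with values in $[-\pi/2,\pi/2]$. The symbol $\sim$ between oscillatory quantities is used in the sense of the leading term in the method of stationary phase: the difference of the two sides is $o(n^{1/2})$, i.e. of smaller order than the amplitude $\left(\frac{n\pi y}{2\sqrt{1-y^2}}\right)^{1/2}$, as $n\to\infty$ (through integers of the given parity, $y$ fixed). *)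

theory Defs
  imports "HOL-Analysis.Analysis" "HOL-Library.Landau_Symbols"
begin

definition hyp3F1 :: "nat \<Rightarrow> complex \<Rightarrow> complex" where
  "hyp3F1 n w =
     (\<Sum>k=0..n. pochhammer (- of_nat n) k * pochhammer (of_nat n) k * pochhammer 1 k
                / (pochhammer (1/2) k * fact k) * w ^ k)"

definition G :: "nat \<Rightarrow> real \<Rightarrow> complex" where
  "G n y = exp (- \<i> * of_nat n / of_real y) * hyp3F1 n (\<i> * of_real y / (2 * of_nat n))"

definition amplitude :: "real \<Rightarrow> nat \<Rightarrow> real" where
  "amplitude y n = sqrt (real n * pi * y / (2 * sqrt (1 - y\<^sup>2)))"

definition phase :: "real \<Rightarrow> nat \<Rightarrow> real" where
  "phase y n = real n * (sqrt (1 - y\<^sup>2) / y + arcsin y) - pi / 4"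

(* Asymptotic equality of oscillatory quantities along a filter F, in the sense of the leading
   term of the method of stationary phase: the error is o(sqrt n).  Unlike asymp_equiv, this
   does not require the quotient to tend to 1, which would fail near zeros of the oscillation. *)
definition osc_equiv :: "nat filter \<Rightarrow> (nat \<Rightarrow> real) \<Rightarrow> (nat \<Rightarrow> real) \<Rightarrow> bool" where
  "osc_equiv F f g \<longleftrightarrow> (\<lambda>n. f n - g n) \<in> o[F](\<lambda>n. sqrt (real n))"

definition even_at_top :: "nat filter" where
  "even_at_top = inf at_top (principal {n. even n})"

definition odd_at_top :: "nat filter" where
  "odd_at_top = inf at_top (principal {n. odd n})"

end

theory Submission
  imports Defs "HOL-Real_Asymp.Real_Asymp"
begin

text \<open>
  Why the theorem holds. Write \<open>l = n / y\<close> and \<open>w = i y / (2 n)\<close>, so that \<open>w = - 1 / (2 i l)\<close>. The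
  Chebyshev polynomial of degree \<open>n\<close>, in the variable \<open>u = (1 - x) / 2\<close>, is the polynomial
  \<open>U\<close> with coefficients \<open>(-n)\<^sub>k (n)\<^sub>k / ((1/2)\<^sub>k k!)\<close>. The extra factor \<open>(1)\<^sub>k = k!\<close> in the
  hypergeometric sum therefore turns coefficients into derivatives: the sum is the value at \<open>u = 0\<close> of
  \<open>Q = (1 - w d/du)\<^sup>-\<^sup>1 U\<close>, the sum of \<open>w\<^sup>k U\<^sup>(\<^sup>k\<^sup>)\<close>. The relation \<open>Q - w Q' = U\<close>
  says exactly that \<open>exp (2 i l u) Q\<close> is, up to a constant factor, an antiderivative of
  \<open>exp (2 i l u) U\<close>. On the range from \<open>x = 1\<close> to \<open>x = 0\<close>, the substitution \<open>x = cos \<theta>\<close> and one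
  integration by parts express \<open>G n y\<close> as \<open>Q (1/2)\<close>, plus bounded terms, plus \<open>n\<close> times an
  oscillatory integral (\<open>G_integral\<close>). Since \<open>U\<close> is even or odd about \<open>u = 1/2\<close> according to the parity
  of \<open>n\<close>, and \<open>w\<close> is purely imaginary, \<open>Q (1/2)\<close> is real for even \<open>n\<close> and imaginary for odd \<open>n\<close>.
  It thus disappears from the part of \<open>G n y\<close> that is studied; this is why parity enters.

  The oscillatory integral splits into two exponential integrals over the interval from \<open>0\<close> to
  \<open>pi / 2\<close>, with phases \<open>n (\<theta> - cos \<theta> / y)\<close> and \<open>n (\<theta> + cos \<theta> / y)\<close>. The first phase has no
  stationary point, and its integral is of order \<open>1 / n\<close>. The second one is stationary only where
  \<open>sin \<theta> = y\<close>, and there its value is \<open>n (arcsin y + sqrt (1 - y\<^sup>2) / y)\<close>, which is the argument in the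
  theorem up to \<open>pi / 4\<close>.

  The stationary phase asymptotics rest on \<open>stationary_phase_endpoint\<close>. After the interval
  is cut at the stationary point, each half has a convex phase \<open>q\<close> that vanishes to second order at
  its left end. On a piece of length \<open>R / sqrt (n k)\<close>, where \<open>q\<close> is close to \<open>k t\<^sup>2\<close>, the integral is a
  Fresnel integral up to \<open>R\<close>; on the rest the van der Corput inequality gives a bound proportional to
  \<open>1 / R\<close> relative to the main term. Letting first \<open>n\<close> and then \<open>R\<close> grow leaves the complete
  Fresnel integral, whose value is \<open>fresnel_tendsto\<close>.
\<close>

section \<open>Oscillatory integrals without a stationary point\<close>

lemma norm_cis_diff_le: "norm (cis a - cis b) \<le> \<bar>a - b\<bar>"
proof -
  have "cis a - cis b = cis b * (cis (a - b) - 1)"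
    by (simp add: cis_mult algebra_simps)
  then have "norm (cis a - cis b) = norm (cis (a - b) - 1)"
    by (simp add: norm_mult)
  also have "\<dots> \<le> \<bar>a - b\<bar>"
    using abs_sin_x_le_abs_x[of "(a - b) / 2"] dist_exp_i_1[of "a - b"] by (simp add: cis_conv_exp)
  finally show ?thesis .
qed

text \<open>
  Integration by parts with the antiderivative \<open>- i h cis q\<close> of the integrand: what it leaves over is the
  integral of \<open>h' cis q\<close>, at most the total variation of the decreasing function \<open>h\<close>, and nothing depends on how
  fast \<open>cis q\<close> rotates. Integrands without a factor \<open>q'\<close> are covered by choosing \<open>h\<close> to be the
  amplitude divided by \<open>q'\<close>.
\<close>

lemma van_der_corput:
  fixes h h' q q' :: "real \<Rightarrow> real"
  assumes "a \<le> b"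
    and h: "\<And>x. x \<in> {a..b} \<Longrightarrow> (h has_real_derivative h' x) (at x within {a..b})"
    and q: "\<And>x. x \<in> {a..b} \<Longrightarrow> (q has_real_derivative q' x) (at x within {a..b})"
    and h': "continuous_on {a..b} h'" "\<And>x. x \<in> {a..b} \<Longrightarrow> h' x \<le> 0"
    and hb: "0 \<le> h b"
  shows "norm (integral {a..b} (\<lambda>x. of_real (h x * q' x) * cis (q x))) \<le> 2 * h a"
proof -
  define F where "F = (\<lambda>x. - \<i> * of_real (h x) * cis (q x))"
  define R where "R = (\<lambda>x. - \<i> * of_real (h' x) * cis (q x))"
  have "continuous_on {a..b} q"
    using q DERIV_continuous_on by blast
  then have R: "R integrable_on {a..b}"
    unfolding R_def using h'(1) by (intro integrable_continuous_real continuous_intros)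
  have F: "((\<lambda>x. R x + of_real (h x * q' x) * cis (q x)) has_integral F b - F a) {a..b}"
  proof (rule fundamental_theorem_of_calculus[OF \<open>a \<le> b\<close>])
    fix x assume x: "x \<in> {a..b}"
    have d1: "((\<lambda>x. cis (q x)) has_vector_derivative (q' x *\<^sub>R (\<i> * cis (q x)))) (at x within {a..b})"
      unfolding has_vector_derivative_def
      by (rule derivative_eq_intros q[OF x, unfolded has_field_derivative_def] refl)+
         (auto simp: fun_eq_iff scaleR_conv_of_real)
    have d2: "((\<lambda>x. complex_of_real (h x)) has_vector_derivative of_real (h' x)) (at x within {a..b})"
      using h[OF x] by (simp add: has_real_derivative_iff_has_vector_derivative has_vector_derivative_of_real)
    have d: "((\<lambda>x. of_real (h x) * cis (q x)) has_vector_derivative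
       (of_real (h x) * (q' x *\<^sub>R (\<i> * cis (q x))) + of_real (h' x) * cis (q x))) (at x within {a..b})"
      by (rule has_vector_derivative_mult[OF d2 d1])
    show "(F has_vector_derivative R x + of_real (h x * q' x) * cis (q x)) (at x within {a..b})"
      using has_vector_derivative_mult_right[OF d, of "-\<i>"]
      unfolding F_def R_def by (simp add: algebra_simps scaleR_conv_of_real)
  qed
  have main: "integral {a..b} (\<lambda>x. of_real (h x * q' x) * cis (q x)) = F b - F a - integral {a..b} R"
    using has_integral_diff[OF F integrable_integral[OF R]] by (simp add: integral_unique)
  have ih: "((\<lambda>x. - h' x) has_integral (- h b - (- h a))) {a..b}"
    using h by (intro fundamental_theorem_of_calculus[OF \<open>a \<le> b\<close>])
       (auto simp: has_real_derivative_iff_has_vector_derivative[symmetric] intro!: derivative_intros)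
  have "norm (integral {a..b} R) \<le> integral {a..b} (\<lambda>x. - h' x)"
    using h'(2) by (intro integral_norm_bound_integral R has_integral_integrable[OF ih])
        (auto simp: R_def norm_mult)
  then have nR: "norm (integral {a..b} R) \<le> h a - h b"
    using integral_unique[OF ih] by simp
  have "norm (F a) = \<bar>h a\<bar>" "norm (F b) = \<bar>h b\<bar>"
    by (simp_all add: F_def norm_mult)
  moreover have "h a \<ge> h b" using nR norm_ge_zero[of "integral {a..b} R"] by linarith
  moreover have "norm (F b - F a - integral {a..b} R) \<le> norm (F b) + norm (F a) + norm (integral {a..b} R)"
    by (smt (verit) norm_triangle_ineq4)
  ultimately show ?thesis unfolding main using hb nR by simp
qed

text \<open>
  For a convex phase \<open>1 / q'\<close> is decreasing, so the speed of rotation at the left end alone controls the integral.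
\<close>

lemma van_der_corput_convex:
  fixes q q' q'' :: "real \<Rightarrow> real"
  assumes "a \<le> b"
    and q: "\<And>x. x \<in> {a..b} \<Longrightarrow> (q has_real_derivative q' x) (at x within {a..b})"
    and q': "\<And>x. x \<in> {a..b} \<Longrightarrow> (q' has_real_derivative q'' x) (at x within {a..b})"
    and q'': "continuous_on {a..b} q''" "\<And>x. x \<in> {a..b} \<Longrightarrow> q'' x \<ge> 0"
    and pos: "0 < q' a"
  shows "norm (integral {a..b} (\<lambda>x. cis (q x))) \<le> 2 / q' a"
proof -
  have mono: "q' a \<le> q' x" if "x \<in> {a..b}" for x
  proof (rule DERIV_nonneg_imp_increasing_open[of a x q'])
    show "a \<le> x" using that by simp
    show "continuous_on {a..x} q'"
      using DERIV_continuous_on[OF q'] that by (auto intro: continuous_on_subset)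
    fix z assume z: "a < z" "z < x"
    then have "z \<in> {a..b}" "z \<in> interior {a..b}" using that by auto
    then show "\<exists>y. (q' has_real_derivative y) (at z) \<and> 0 \<le> y"
      using q' q''(2) at_within_interior by metis
  qed
  have pos': "q' x > 0" if "x \<in> {a..b}" for x using mono[OF that] pos by linarith
  have "norm (integral {a..b} (\<lambda>x. of_real (inverse (q' x) * q' x) * cis (q x))) \<le> 2 * inverse (q' a)"
  proof (rule van_der_corput[OF \<open>a \<le> b\<close> _ q])
    show "((\<lambda>x. inverse (q' x)) has_real_derivative - (q'' x / (q' x)\<^sup>2)) (at x within {a..b})"
      if "x \<in> {a..b}" for x
      using pos'[OF that] q'[OF that]
      by (auto intro!: derivative_eq_intros simp: field_simps power2_eq_square)
    have "continuous_on {a..b} q'" using DERIV_continuous_on[OF q'] by blast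
    then show "continuous_on {a..b} (\<lambda>x. - (q'' x / (q' x)\<^sup>2))"
      using q''(1) pos' by (intro continuous_intros) force+
  qed (use q'' pos' \<open>a \<le> b\<close> in \<open>auto simp: less_imp_le\<close>)
  moreover have "integral {a..b} (\<lambda>x. of_real (inverse (q' x) * q' x) * cis (q x)) = integral {a..b} (\<lambda>x. cis (q x))"
    using pos' by (intro integral_cong) force
  ultimately show ?thesis by (simp add: divide_inverse)
qed

section \<open>The Fresnel integral\<close>

definition fresnel :: "real \<Rightarrow> complex" where
  "fresnel t = integral {0..t} (\<lambda>x. cis (x\<^sup>2))"

text \<open>
  The value of the Fresnel integral is found below through its square, and this fact selects the
  root. Integrating \<open>sin (x\<^sup>2) = (2 x sin (x\<^sup>2)) / (2 x)\<close> by parts shows it: the boundary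
  term \<open>(1 - cos (t\<^sup>2)) / (2 t)\<close> and the remaining integrand are both nonnegative.
\<close>

lemma fresnel_Im_nonneg: assumes "t \<ge> 0" shows "0 \<le> Im (fresnel t)"
proof -
  define F :: "real \<Rightarrow> real" where "F = (\<lambda>x. (1 - cos (x\<^sup>2)) / (2 * x))"
  define F' :: "real \<Rightarrow> real" where "F' = (\<lambda>x. sin (x\<^sup>2) - (1 - cos (x\<^sup>2)) / (2 * x\<^sup>2))"
  \<comment> \<open>\<open>F\<close> takes the value \<open>0\<close> at \<open>0\<close> because division by \<open>0\<close> gives \<open>0\<close>, and this is its limit.\<close>
  have "(F \<longlongrightarrow> 0) (at_right 0)" unfolding F_def by real_asymp
  then have c0: "(F \<longlongrightarrow> F 0) (at 0 within {0..t})"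
    using assms by (cases "t = 0") (auto simp: F_def at_within_Icc_at_right, simp add: at_within_def)
  have F: "(F' has_integral (F t - F 0)) {0..t}"
  proof (rule fundamental_theorem_of_calculus_interior[OF assms])
    have "continuous (at x within {0..t}) F" if "x \<in> {0..t}" for x
    proof (cases "x = 0")
      case True then show ?thesis using c0 by (simp add: continuous_within)
    next
      case False then show ?thesis unfolding F_def by (intro continuous_intros) auto
    qed
    then show "continuous_on {0..t} F" by (simp add: continuous_on_eq_continuous_within)
    show "(F has_vector_derivative F' x) (at x)" if "x \<in> {0<..<t}" for x
      unfolding F_def F'_def has_real_derivative_iff_has_vector_derivative[symmetric] using that
      by (auto intro!: derivative_eq_intros simp: field_simps power2_eq_square)
  qed
  have I: "((\<lambda>x. cis (x\<^sup>2)) has_integral fresnel t) {0..t}"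
    unfolding fresnel_def by (intro integrable_integral integrable_continuous_real continuous_intros)
  have "((\<lambda>x. sin (x\<^sup>2)) has_integral Im (fresnel t)) {0..t}"
    using has_integral_linear[OF I bounded_linear_Im] by (simp add: o_def)
  then have "F t - F 0 \<le> Im (fresnel t)"
    by (rule has_integral_le[OF F]) (auto simp: F'_def)
  moreover have "F t \<ge> 0" "F 0 = 0" using assms by (auto simp: F_def)
  ultimately show ?thesis by simp
qed

lemma fresnel_scale:
  fixes c R :: real assumes "c > 0"
  shows "integral {0..R / c} (\<lambda>x. cis ((c * x)\<^sup>2)) = fresnel R /\<^sub>R c"
proof (cases "R \<ge> 0")
  case True
  have "(\<lambda>x. x / c) ` {0..R} = {0..R / c}"
    using assms True by simp
  then show ?thesis
    using integral_stretch_real[of c 0 R "\<lambda>x. cis (x\<^sup>2)"] assms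
    by (simp add: fresnel_def divide_inverse)
next
  case False
  then have "R / c < 0" using assms by (simp add: divide_neg_pos)
  then show ?thesis using False by (simp add: fresnel_def)
qed

text \<open>
  The companion integral in the classical evaluation of the Gaussian integral by differentiation
  under the integral sign, here with an imaginary exponent. Its derivative is a multiple of the derivative of the
  square of the Fresnel integral.
\<close>

definition fresnel_aux :: "real \<Rightarrow> complex" where
  "fresnel_aux t = integral {0..1} (\<lambda>x. of_real (inverse (1 + x\<^sup>2)) * cis (t\<^sup>2 * (1 + x\<^sup>2)))"

lemma one_plus_square_ne0: "1 + x\<^sup>2 \<noteq> (0::real)"
  by (smt (verit) zero_le_power2)

lemma fresnel_aux_deriv:
  assumes t: "t \<in> {0..T}"
  shows "(fresnel_aux has_vector_derivative 2 * \<i> * cis (t\<^sup>2) * fresnel t) (at t within {0..T})"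
proof -
  define D where "D = (\<lambda>t x :: real. of_real (2 * t) * \<i> * cis (t\<^sup>2 * (1 + x\<^sup>2)))"
  have "((\<lambda>t. integral (cbox 0 1) (\<lambda>x. of_real (inverse (1 + x\<^sup>2)) * cis (t\<^sup>2 * (1 + x\<^sup>2))))
     has_vector_derivative integral (cbox 0 1) (D t)) (at t within {0..T})"
  proof (rule leibniz_rule_vector_derivative)
    fix s x :: real
    have d: "((\<lambda>s. cis (s\<^sup>2 * (1 + x\<^sup>2))) has_vector_derivative
        ((2 * s * (1 + x\<^sup>2)) *\<^sub>R (\<i> * cis (s\<^sup>2 * (1 + x\<^sup>2))))) (at s within {0..T})"
      unfolding has_vector_derivative_def
      by (rule derivative_eq_intros refl)+ (auto simp: fun_eq_iff scaleR_conv_of_real)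
    have e: "complex_of_real (inverse (1 + x\<^sup>2)) * ((2 * s * (1 + x\<^sup>2)) *\<^sub>R (\<i> * cis (s\<^sup>2 * (1 + x\<^sup>2)))) = D s x"
    proof -
      have "complex_of_real a * (b *\<^sub>R z) = (a * b) *\<^sub>R z" for a b z
        by (simp add: scaleR_conv_of_real)
      moreover have "inverse (1 + x\<^sup>2) * (2 * s * (1 + x\<^sup>2)) = 2 * s"
        using one_plus_square_ne0[of x] by simp
      ultimately show ?thesis by (simp only: D_def) (simp add: scaleR_conv_of_real)
    qed
    show "((\<lambda>s. of_real (inverse (1 + x\<^sup>2)) * cis (s\<^sup>2 * (1 + x\<^sup>2))) has_vector_derivative D s x) (at s within {0..T})"
      using has_vector_derivative_mult_right[OF d, of "of_real (inverse (1 + x\<^sup>2))"] unfolding e .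
  next
    fix s :: real
    show "(\<lambda>x. of_real (inverse (1 + x\<^sup>2)) * cis (s\<^sup>2 * (1 + x\<^sup>2))) integrable_on cbox 0 1"
      using one_plus_square_ne0 by (intro integrable_continuous continuous_intros) auto
  next
    show "continuous_on ({0..T} \<times> cbox 0 1) (\<lambda>(t, x). D t x)"
      unfolding D_def case_prod_beta by (intro continuous_intros)
  qed (use t in auto)
  moreover have "integral (cbox 0 1) (D t) = 2 * \<i> * cis (t\<^sup>2) * fresnel t"
  proof (cases "t = 0")
    case True then show ?thesis by (simp add: D_def fresnel_def)
  next
    case False
    then have "t > 0" using t by auto
    have "D t = (\<lambda>x. (of_real (2 * t) * \<i> * cis (t\<^sup>2)) * cis ((t * x)\<^sup>2))"
      by (simp add: D_def fun_eq_iff cis_mult algebra_simps power_mult_distrib)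
    moreover have "integral {0..1} (\<lambda>x. cis ((t * x)\<^sup>2)) = fresnel t /\<^sub>R t"
      using fresnel_scale[OF \<open>t > 0\<close>, of t] \<open>t > 0\<close> by simp
    ultimately show ?thesis
      using \<open>t > 0\<close> by (simp add: scaleR_conv_of_real)
  qed
  ultimately show ?thesis unfolding fresnel_aux_def[abs_def] by simp
qed

text \<open>
  The derivatives of the two summands cancel, so their sum is constant.
\<close>

lemma fresnel_square:
  assumes "t \<ge> 0" shows "(fresnel t)\<^sup>2 + \<i> * fresnel_aux t = \<i> * of_real (pi / 4)"
proof -
  have "((\<lambda>t. (fresnel t)\<^sup>2 + \<i> * fresnel_aux t) has_vector_derivative 0) (at s within {0..t})"
    if s: "s \<in> {0..t}" for s
  proof -
    have d: "(fresnel has_vector_derivative cis (s\<^sup>2)) (at s within {0..t})"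
      unfolding fresnel_def using s
      by (intro integral_has_vector_derivative continuous_intros) auto
    show ?thesis
      using has_vector_derivative_add[OF has_vector_derivative_mult[OF d d]
              has_vector_derivative_mult_right[OF fresnel_aux_deriv[OF s], of \<i>]]
      by (simp add: power2_eq_square algebra_simps)
  qed
  then obtain c where c: "\<And>s. s \<in> {0..t} \<Longrightarrow> (fresnel s)\<^sup>2 + \<i> * fresnel_aux s = c"
    using has_vector_derivative_zero_constant[of "{0..t}"] by auto
  \<comment> \<open>The constant is found at \<open>t = 0\<close>, where only the integral of \<open>1 / (1 + x\<^sup>2)\<close> remains.\<close>
  have "((\<lambda>x. inverse (1 + x\<^sup>2)) has_integral (arctan 1 - arctan 0)) {0..1::real}"
    by (intro fundamental_theorem_of_calculus)
       (auto intro!: derivative_eq_intros simp: has_real_derivative_iff_has_vector_derivative[symmetric])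
  then have "((\<lambda>x. complex_of_real (inverse (1 + x\<^sup>2))) has_integral of_real (pi / 4)) {0..1::real}"
    using has_integral_of_real[where 'b = complex] by (force simp only: arctan_one arctan_zero_zero diff_0_right)
  then have "fresnel_aux 0 = of_real (pi / 4)"
    unfolding fresnel_aux_def by (simp add: integral_unique)
  then have "c = \<i> * of_real (pi / 4)" using c[of 0] assms by (auto simp: fresnel_def)
  then show ?thesis using c[of t] assms by simp
qed

text \<open>
  The phase \<open>t\<^sup>2 (1 + x\<^sup>2)\<close> is stationary at \<open>x = 0\<close>. Below \<open>x = 1 / t\<close> the trivial bound is used, above
  it the van der Corput inequality; this cut balances the two contributions.
\<close>

lemma fresnel_aux_bound:
  assumes "t \<ge> 1" shows "norm (fresnel_aux t) \<le> 2 / t"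
proof -
  define g where "g = (\<lambda>x. complex_of_real (inverse (1 + x\<^sup>2)) * cis (t\<^sup>2 * (1 + x\<^sup>2)))"
  define d where "d = 1 / t"
  have d: "0 < d" "d \<le> 1" using assms by (auto simp: d_def)
  have int: "g integrable_on {a..b}" for a b
    unfolding g_def using one_plus_square_ne0 by (intro integrable_continuous_real continuous_intros) auto
  have "norm (integral {0..d} g) \<le> integral {0..d} (\<lambda>x. 1)"
  proof (intro integral_norm_bound_integral int)
    fix x :: real
    have "norm (g x) = \<bar>inverse (1 + x\<^sup>2)\<bar>"
      unfolding g_def norm_mult norm_of_real by simp
    also have "\<dots> = inverse (1 + x\<^sup>2)" by simp
    also have "\<dots> \<le> 1" by (simp add: inverse_le_1_iff)
    finally show "norm (g x) \<le> 1" .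
  qed auto
  then have 1: "norm (integral {0..d} g) \<le> 1 / t" using d by (simp add: d_def)
  define h where "h = (\<lambda>x::real. 1 / (2 * t\<^sup>2 * (x * (1 + x\<^sup>2))))"
  define h' where "h' = (\<lambda>x::real. - ((1 + 3 * x\<^sup>2) / (2 * t\<^sup>2 * (x * (1 + x\<^sup>2))\<^sup>2)))"
  have nz: "t \<noteq> 0" "x \<in> {d..1} \<Longrightarrow> x \<noteq> 0" for x using assms d by auto
  have "norm (integral {d..1} (\<lambda>x. of_real (h x * (2 * t\<^sup>2 * x)) * cis (t\<^sup>2 * (1 + x\<^sup>2)))) \<le> 2 * h d"
  proof (rule van_der_corput[OF d(2)])
    fix x assume x: "x \<in> {d..1}"
    show "(h has_real_derivative h' x) (at x within {d..1})"
      unfolding h_def h'_def using nz(1) nz(2)[OF x] one_plus_square_ne0[of x]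
      by (auto intro!: derivative_eq_intros, simp add: divide_simps power2_eq_square, simp add: algebra_simps)
    show "((\<lambda>x. t\<^sup>2 * (1 + x\<^sup>2)) has_real_derivative 2 * t\<^sup>2 * x) (at x within {d..1})"
      by (auto intro!: derivative_eq_intros)
    show "h' x \<le> 0" by (simp add: h'_def)
  next
    show "continuous_on {d..1} h'" unfolding h'_def using nz one_plus_square_ne0
      by (intro continuous_intros) auto
    show "0 \<le> h 1" by (simp add: h_def)
  qed
  also have "integral {d..1} (\<lambda>x. of_real (h x * (2 * t\<^sup>2 * x)) * cis (t\<^sup>2 * (1 + x\<^sup>2))) = integral {d..1} g"
  proof (rule integral_cong)
    fix x assume "x \<in> {d..1}"
    then have "h x * (2 * t\<^sup>2 * x) = inverse (1 + x\<^sup>2)"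
      using nz one_plus_square_ne0[of x] by (simp add: h_def divide_simps)
    then show "of_real (h x * (2 * t\<^sup>2 * x)) * cis (t\<^sup>2 * (1 + x\<^sup>2)) = g x"
      by (simp add: g_def)
  qed
  also have "2 * h d \<le> 1 / t"
  proof -
    have "2 * h d = 1 / (t * (1 + d\<^sup>2))"
      using nz(1) by (simp add: h_def d_def power2_eq_square)
    also have "\<dots> \<le> 1 / (t * 1)" using assms by (intro divide_left_mono mult_left_mono mult_pos_pos) (auto intro: add_pos_nonneg)
    finally show ?thesis by simp
  qed
  finally have 2: "norm (integral {d..1} g) \<le> 1 / t" .
  have "integral {0..d} g + integral {d..1} g = fresnel_aux t"
    unfolding fresnel_aux_def g_def[symmetric] by (rule Henstock_Kurzweil_Integration.integral_combine) (use d int in auto)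
  then show ?thesis using 1 2 norm_triangle_ineq[of "integral {0..d} g" "integral {d..1} g"] by simp
qed

text \<open>
  The square of the Fresnel integral tends to \<open>i pi / 4 = L\<^sup>2\<close>. As its imaginary part is nonnegative and
  that of \<open>L\<close> is positive, it stays away from \<open>- L\<close>, so it must approach \<open>L\<close>.
\<close>

lemma fresnel_tendsto: "(fresnel \<longlongrightarrow> of_real (sqrt pi / 2) * cis (pi / 4)) at_top"
proof -
  define L where "L = of_real (sqrt pi / 2) * cis (pi / 4)"
  have L2: "L\<^sup>2 = \<i> * of_real (pi / 4)"
  proof -
    have "(cis (pi / 4))\<^sup>2 = \<i>" by (simp add: power2_eq_square cis_mult)
    then show ?thesis by (simp add: L_def power_mult_distrib power_divide flip: of_real_power)
  qed
  have ImL: "Im L > 0" by (simp add: L_def sin_45)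
  have "((\<lambda>t. 2 / t / Im L) \<longlongrightarrow> 0) at_top"
    using ImL by real_asymp
  then have "((\<lambda>t. fresnel t - L) \<longlongrightarrow> 0) at_top"
  proof (rule Lim_null_comparison[rotated])
    show "\<forall>\<^sub>F t in at_top. norm (fresnel t - L) \<le> 2 / t / Im L"
      using eventually_ge_at_top[of 1]
    proof eventually_elim
      case (elim t)
      have "(fresnel t - L) * (fresnel t + L) = - \<i> * fresnel_aux t"
        using fresnel_square[of t, folded L2] elim by (simp add: algebra_simps power2_eq_square)
      then have "norm (fresnel t - L) * norm (fresnel t + L) \<le> 2 / t"
        using fresnel_aux_bound[OF elim] by (simp add: norm_mult flip: norm_mult[of "fresnel t - L"])
      moreover have "Im L \<le> norm (fresnel t + L)"
        using fresnel_Im_nonneg[of t] elim abs_Im_le_cmod[of "fresnel t + L"] by simp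
      ultimately have "norm (fresnel t - L) * Im L \<le> 2 / t"
        by (meson mult_left_mono norm_ge_zero order_trans)
      then show ?case by (simp only: pos_le_divide_eq[OF ImL])
    qed
  qed
  then show ?thesis unfolding L_def by (rule LIM_zero_cancel)
qed

section \<open>A stationary point at an end of the interval\<close>

lemma nonneg_if_deriv_nonneg:
  fixes f f' :: "real \<Rightarrow> real"
  assumes "\<And>x. x \<in> {0..d} \<Longrightarrow> (f has_real_derivative f' x) (at x within {0..d})"
    and "\<And>x. x \<in> {0..d} \<Longrightarrow> f' x \<ge> 0" and "f 0 = 0" and t: "t \<in> {0..d}"
  shows "f t \<ge> 0"
proof -
  have "(f has_real_derivative f' x) (at x within {0..t})" if "x \<in> {0..t}" for x
    by (rule DERIV_subset[OF assms(1)]) (use that t in auto)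
  then have "(f' has_integral (f t - f 0)) {0..t}"
    using t by (intro fundamental_theorem_of_calculus)
      (auto simp: has_real_derivative_iff_has_vector_derivative[symmetric])
  then have "0 \<le> f t - f 0"
    by (rule has_integral_nonneg) (use assms t in auto)
  then show ?thesis using assms by simp
qed

text \<open>
  Continuity of the second derivative at \<open>0\<close>, integrated twice. Each bound on an absolute value is proved as a pair of
  one-sided bounds, with \<open>\<sigma>\<close> standing for either sign.
\<close>

lemma quadratic_contact:
  fixes q q' q'' :: "real \<Rightarrow> real"
  assumes "b > 0"
    and q: "\<And>x. x \<in> {0..b} \<Longrightarrow> (q has_real_derivative q' x) (at x within {0..b})"
    and q': "\<And>x. x \<in> {0..b} \<Longrightarrow> (q' has_real_derivative q'' x) (at x within {0..b})"
    and q'': "continuous_on {0..b} q''" "q'' 0 = 2 * k"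
    and 0: "q 0 = 0" "q' 0 = 0" and "e > 0"
  obtains d where "0 < d" "d \<le> b"
    "\<And>t. t \<in> {0..d} \<Longrightarrow> \<bar>q' t - 2 * k * t\<bar> \<le> 2 * e * t"
    "\<And>t. t \<in> {0..d} \<Longrightarrow> \<bar>q t - k * t\<^sup>2\<bar> \<le> e * t\<^sup>2"
proof -
  obtain r where r: "r > 0" "\<And>x. x \<in> {0..b} \<Longrightarrow> \<bar>x\<bar> < r \<Longrightarrow> \<bar>q'' x - 2 * k\<bar> < 2 * e"
    using q''(1)[unfolded continuous_on_iff, rule_format, of 0 "2 * e"] \<open>b > 0\<close> \<open>e > 0\<close>
    by (auto simp: dist_real_def q''(2))
  define d where "d = min b (r / 2)"
  have d: "0 < d" "d \<le> b" using \<open>b > 0\<close> r(1) by (auto simp: d_def)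
  have near: "\<bar>q'' x - 2 * k\<bar> \<le> 2 * e" if "x \<in> {0..d}" for x
    using r that by (intro less_imp_le r(2)) (auto simp: d_def)
  have dq: "(q has_real_derivative q' x) (at x within {0..d})"
       "(q' has_real_derivative q'' x) (at x within {0..d})" if "x \<in> {0..d}" for x
    by (rule DERIV_subset[OF q] DERIV_subset[OF q']; use that d(2) in auto)+
  have 1: "\<sigma> * (q' t - 2 * k * t) + 2 * e * t \<ge> 0" if "t \<in> {0..d}" "\<bar>\<sigma>\<bar> = 1" for t \<sigma>
  proof (rule nonneg_if_deriv_nonneg[OF _ _ _ that(1)])
    fix x assume x: "x \<in> {0..d}"
    show "((\<lambda>t. \<sigma> * (q' t - 2 * k * t) + 2 * e * t) has_real_derivative \<sigma> * (q'' x - 2 * k) + 2 * e) (at x within {0..d})"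
      by (auto intro!: derivative_eq_intros dq[OF x])
    show "0 \<le> \<sigma> * (q'' x - 2 * k) + 2 * e" using near[OF x] that(2) by (cases "\<sigma> = 1") (auto simp: abs_if split: if_splits)
  qed (simp add: 0)
  have 2: "\<sigma> * (q t - k * t\<^sup>2) + e * t\<^sup>2 \<ge> 0" if "t \<in> {0..d}" "\<bar>\<sigma>\<bar> = 1" for t \<sigma>
  proof (rule nonneg_if_deriv_nonneg[OF _ _ _ that(1)])
    fix x assume x: "x \<in> {0..d}"
    show "((\<lambda>t. \<sigma> * (q t - k * t\<^sup>2) + e * t\<^sup>2) has_real_derivative \<sigma> * (q' x - 2 * k * x) + 2 * e * x) (at x within {0..d})"
      by (auto intro!: derivative_eq_intros dq[OF x])
    show "0 \<le> \<sigma> * (q' x - 2 * k * x) + 2 * e * x" using 1[OF x that(2)] .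
  qed (simp add: 0)
  show ?thesis
    by (rule that[OF d]) (use 1[where \<sigma> = 1] 1[where \<sigma> = "-1"] 2[where \<sigma> = 1] 2[where \<sigma> = "-1"] in
       \<open>force simp: abs_le_iff algebra_simps\<close>)+
qed

text \<open>
  The cut is at distance \<open>R / sqrt (n k)\<close> from the stationary point, the scale on which \<open>n q\<close> varies by a
  quantity of order one. Left of it the integral is comparable with a Fresnel integral, with an error that
  is small for fixed \<open>R\<close>; right of it \<open>q'\<close> is at least \<open>k R / sqrt (n k)\<close>, and convexity makes the
  remaining part smaller than the main term by a factor of order \<open>1 / R\<close>.
\<close>

lemma stationary_phase_endpoint:
  fixes q q' q'' :: "real \<Rightarrow> real"
  assumes "b > 0"
    and q: "\<And>x. x \<in> {0..b} \<Longrightarrow> (q has_real_derivative q' x) (at x within {0..b})"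
    and q': "\<And>x. x \<in> {0..b} \<Longrightarrow> (q' has_real_derivative q'' x) (at x within {0..b})"
    and q'': "continuous_on {0..b} q''" "\<And>x. x \<in> {0..b} \<Longrightarrow> q'' x \<ge> 0" "q'' 0 = 2 * k" "k > 0"
    and 0: "q 0 = 0" "q' 0 = 0"
  shows "(\<lambda>n. sqrt (real n) *\<^sub>R integral {0..b} (\<lambda>t. cis (real n * q t)))
     \<longlonglongrightarrow> (of_real (sqrt pi / 2) * cis (pi / 4)) /\<^sub>R sqrt k"
proof -
  define L where "L = of_real (sqrt pi / 2) * cis (pi / 4)"
  define J where "J = (\<lambda>n. integral {0..b} (\<lambda>t. cis (real n * q t)))"
  have contq: "continuous_on {0..b} q" using DERIV_continuous_on[OF q] by blast
  have "(\<lambda>n. sqrt (real n * k) *\<^sub>R J n) \<longlonglongrightarrow> L"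
  proof (rule tendstoI)
    fix \<epsilon> :: real assume \<epsilon>: "\<epsilon> > 0"
    have "\<forall>\<^sub>F R in at_top. dist (fresnel R) L < \<epsilon> / 3"
      using fresnel_tendsto \<epsilon> unfolding L_def by (intro tendstoD) auto
    moreover have "\<forall>\<^sub>F R in at_top. 2 / R < \<epsilon> / 3" using \<epsilon> by real_asymp
    ultimately have "\<forall>\<^sub>F R in at_top. dist (fresnel R) L < \<epsilon> / 3 \<and> 2 / R < \<epsilon> / 3 \<and> R > 0"
      using eventually_gt_at_top[of 0] by eventually_elim auto
    then obtain R where R: "dist (fresnel R) L < \<epsilon> / 3" "2 / R < \<epsilon> / 3" "R > 0"
      using eventually_happens' trivial_limit_at_top_linorder by blast
    \<comment> \<open>The first bound on \<open>e\<close> keeps \<open>q'\<close> above \<open>k t\<close> near \<open>0\<close>; the second one makes the error of the Fresnel comparison at most \<open>\<epsilon> / 6\<close>.\<close>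
    define e where "e = min (k / 2) (k * \<epsilon> / (6 * R ^ 3))"
    have e: "e > 0" "e \<le> k / 2" "e * R ^ 3 / k \<le> \<epsilon> / 6"
    proof -
      show "e > 0" "e \<le> k / 2" using \<epsilon> R \<open>k > 0\<close> by (auto simp: e_def)
      have "e \<le> k * \<epsilon> / (6 * R ^ 3)" by (simp add: e_def)
      then show "e * R ^ 3 / k \<le> \<epsilon> / 6" using R \<open>k > 0\<close> by (simp add: field_simps)
    qed
    obtain d where d: "0 < d" "d \<le> b"
      and d1: "\<And>t. t \<in> {0..d} \<Longrightarrow> \<bar>q' t - 2 * k * t\<bar> \<le> 2 * e * t"
      and d2: "\<And>t. t \<in> {0..d} \<Longrightarrow> \<bar>q t - k * t\<^sup>2\<bar> \<le> e * t\<^sup>2"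
      using quadratic_contact[OF \<open>b > 0\<close> q q' q''(1,3) 0 e(1)] by metis
    have "\<forall>\<^sub>F n in sequentially. R / d \<le> sqrt (real n * k)" using \<open>k > 0\<close> by real_asymp
    then show "\<forall>\<^sub>F n in sequentially. dist (sqrt (real n * k) *\<^sub>R J n) L < \<epsilon>"
      using eventually_gt_at_top[of 0]
    proof eventually_elim
      case (elim n)
      define c where "c = sqrt (real n * k)"
      define \<delta> where "\<delta> = R / c"
      have c: "c > 0" "c\<^sup>2 = real n * k" using \<open>k > 0\<close> elim by (auto simp: c_def)
      have \<delta>: "0 < \<delta>" "\<delta> \<le> d" using c R elim d by (auto simp: \<delta>_def c_def field_simps)
      define g where "g = (\<lambda>t. cis (real n * q t))"
      have int: "g integrable_on {x..y}" if "0 \<le> x" "y \<le> b" for x y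
        unfolding g_def using that
        by (intro integrable_continuous_real continuous_intros continuous_on_subset[OF contq]) auto
      have J: "J n = integral {0..\<delta>} g + integral {\<delta>..b} g"
        unfolding J_def g_def[symmetric]
        by (rule Henstock_Kurzweil_Integration.integral_combine[symmetric]) (use \<delta> d int in auto)
      have near: "norm (integral {0..\<delta>} g - fresnel R /\<^sub>R c) \<le> n * e * \<delta> ^ 3"
      proof -
        have "integral {0..\<delta>} g - fresnel R /\<^sub>R c = integral {0..\<delta>} (\<lambda>t. g t - cis ((c * t)\<^sup>2))"
          unfolding fresnel_scale[OF c(1), symmetric] \<delta>_def[symmetric] using \<delta> d
          by (intro integral_diff[symmetric] int integrable_continuous_real continuous_intros) auto
        also have "norm \<dots> \<le> integral {0..\<delta>} (\<lambda>t. n * e * \<delta>\<^sup>2)"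
        proof (rule integral_norm_bound_integral)
          show "(\<lambda>t. g t - cis ((c * t)\<^sup>2)) integrable_on {0..\<delta>}"
            using \<delta> d by (intro integrable_diff int integrable_continuous_real continuous_intros) auto
          fix t assume t: "t \<in> {0..\<delta>}"
          have "norm (g t - cis ((c * t)\<^sup>2)) \<le> \<bar>real n * q t - (c * t)\<^sup>2\<bar>"
            unfolding g_def by (rule norm_cis_diff_le)
          also have "real n * q t - (c * t)\<^sup>2 = real n * (q t - k * t\<^sup>2)"
            by (simp add: power_mult_distrib c algebra_simps)
          also have "\<bar>\<dots>\<bar> = n * \<bar>q t - k * t\<^sup>2\<bar>" by (simp add: abs_mult)
          also have "\<dots> \<le> n * (e * t\<^sup>2)" using d2[of t] t \<delta> by (intro mult_left_mono) auto
          also have "\<dots> \<le> n * (e * \<delta>\<^sup>2)" using t e by (intro mult_left_mono power_mono) auto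
          finally show "norm (g t - cis ((c * t)\<^sup>2)) \<le> n * e * \<delta>\<^sup>2" by (simp add: mult_ac)
        qed auto
        also have "\<dots> = n * e * \<delta> ^ 3" using \<delta> by (simp add: power2_eq_square power3_eq_cube)
        finally show ?thesis .
      qed
      have q'\<delta>: "k * \<delta> \<le> q' \<delta>"
      proof -
        have "2 * e * \<delta> \<le> k * \<delta>" using e(2) \<delta> by (intro mult_right_mono) auto
        moreover have "2 * k * \<delta> - 2 * e * \<delta> \<le> q' \<delta>" using d1[of \<delta>] \<delta> by (simp add: abs_le_iff)
        ultimately show ?thesis by linarith
      qed
      have "norm (integral {\<delta>..b} g) \<le> 2 / (n * q' \<delta>)"
        unfolding g_def
      proof (rule van_der_corput_convex[where q'' = "\<lambda>x. n * q'' x"])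
        show "\<delta> \<le> b" using \<delta> d by simp
        show "continuous_on {\<delta>..b} (\<lambda>x. n * q'' x)"
          using \<delta> by (intro continuous_intros continuous_on_subset[OF q''(1)]) auto
        fix x assume x: "x \<in> {\<delta>..b}"
        then have x': "x \<in> {0..b}" and sub: "{\<delta>..b} \<subseteq> {0..b}" using \<delta> by auto
        show "((\<lambda>x. n * q x) has_real_derivative n * q' x) (at x within {\<delta>..b})"
             "((\<lambda>x. n * q' x) has_real_derivative n * q'' x) (at x within {\<delta>..b})"
          using DERIV_subset[OF q[OF x'] sub] DERIV_subset[OF q'[OF x'] sub] by (auto intro!: derivative_eq_intros)
        show "0 \<le> n * q'' x" using q''(2)[OF x'] by simp
      next
        show "0 < n * q' \<delta>" using q'\<delta> elim \<delta> \<open>k > 0\<close> by (intro mult_pos_pos) (auto intro: less_le_trans[OF _ q'\<delta>])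
      qed
      also have "2 / (n * q' \<delta>) \<le> 2 / (n * (k * \<delta>))"
        using q'\<delta> elim \<delta> \<open>k > 0\<close>
        by (intro divide_left_mono mult_left_mono mult_pos_pos) (auto intro: less_le_trans[OF _ q'\<delta>])
      also have "n * (k * \<delta>) = c * R"
        using c(1) by (simp add: \<delta>_def c(2)[symmetric] power2_eq_square flip: mult.assoc)
      finally have tail: "norm (integral {\<delta>..b} g) \<le> 2 / (c * R)" .
      have "c *\<^sub>R J n - L = c *\<^sub>R (integral {0..\<delta>} g - fresnel R /\<^sub>R c) + c *\<^sub>R integral {\<delta>..b} g + (fresnel R - L)"
        using c by (simp add: J algebra_simps)
      also have "norm \<dots> \<le> c * (n * e * \<delta> ^ 3) + c * (2 / (c * R)) + dist (fresnel R) L"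
        using mult_left_mono[OF near less_imp_le[OF c(1)]] mult_left_mono[OF tail less_imp_le[OF c(1)]] c(1)
        by (intro norm_triangle_mono) (auto simp: dist_norm)
      also have "c * (n * e * \<delta> ^ 3) = e * R ^ 3 / k"
      proof -
        have "c * (n * e * \<delta> ^ 3) = n * e * R ^ 3 / c\<^sup>2"
          using c(1) by (simp add: \<delta>_def power3_eq_cube power2_eq_square)
        then show ?thesis unfolding c(2) using elim by simp
      qed
      also have "c * (2 / (c * R)) = 2 / R" using c by simp
      finally show ?case using e(3) R(1,2) \<epsilon> unfolding dist_norm c_def by linarith
    qed
  qed
  then have "(\<lambda>n. (sqrt (real n * k) *\<^sub>R J n) /\<^sub>R sqrt k) \<longlonglongrightarrow> L /\<^sub>R sqrt k"
    by (intro tendsto_intros)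
  moreover have "(sqrt (real n * k) *\<^sub>R J n) /\<^sub>R sqrt k = sqrt n *\<^sub>R J n" for n
    using \<open>k > 0\<close> by (simp add: real_sqrt_mult)
  ultimately show ?thesis unfolding L_def J_def by (simp only:)
qed

section \<open>The hypergeometric sum and Chebyshev polynomials\<close>

text \<open>
  \<open>shifted_cheb n\<close> is \<open>T\<^sub>n (1 - 2 u)\<close> as a polynomial in \<open>u\<close>, with \<open>T\<^sub>n\<close> the Chebyshev polynomial of the first
  kind. In this variable the hypergeometric expansion is the expansion in powers of \<open>u\<close>, and the symmetry
  \<open>T\<^sub>n (- x) = (-1)\<^sup>n T\<^sub>n x\<close> is the reflection \<open>u \<mapsto> 1 - u\<close>.
\<close>

fun shifted_cheb :: "nat \<Rightarrow> real poly" where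
  "shifted_cheb 0 = 1"
| "shifted_cheb (Suc 0) = [:1, -2:]"
| "shifted_cheb (Suc (Suc n)) = smult 2 ([:1, -2:] * shifted_cheb (Suc n)) - shifted_cheb n"

lemma shifted_cheb_cos: "poly (shifted_cheb n) ((sin (\<theta> / 2))\<^sup>2) = cos (real n * \<theta>)"
proof (induction n rule: shifted_cheb.induct)
  case 2
  have "cos \<theta> = 1 - 2 * (sin (\<theta> / 2))\<^sup>2" using cos_double_sin[of "\<theta> / 2"] by simp
  then show ?case by (simp add: algebra_simps)
next
  case (3 n)
  have "cos \<theta> = 1 - 2 * (sin (\<theta> / 2))\<^sup>2" using cos_double_sin[of "\<theta> / 2"] by simp
  moreover have "cos (real (Suc n) * \<theta> + \<theta>) + cos (real (Suc n) * \<theta> - \<theta>) = 2 * cos \<theta> * cos (real (Suc n) * \<theta>)"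
    by (simp only: cos_add cos_diff) simp
  moreover have "real (Suc n) * \<theta> + \<theta> = real (Suc (Suc n)) * \<theta>" "real (Suc n) * \<theta> - \<theta> = real n * \<theta>"
    by (simp_all add: algebra_simps)
  moreover have "poly (shifted_cheb (Suc (Suc n))) s = 2 * (1 - 2 * s) * poly (shifted_cheb (Suc n)) s - poly (shifted_cheb n) s" for s
    by (simp add: algebra_simps)
  ultimately show ?case using 3 by (simp only:)
qed simp

lemma shifted_cheb_reflect: "pcompose (shifted_cheb n) [:1, -1:] = smult ((-1) ^ n) (shifted_cheb n)"
proof (induction n rule: shifted_cheb.induct)
  case 2 show ?case by (simp add: pcompose_pCons)
next
  case (3 n)
  define P where "P = [:1, -2::real:]"
  have "pcompose P [:1, -1:] = - P" by (simp add: P_def pcompose_pCons)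
  moreover have "shifted_cheb (Suc (Suc n)) = smult 2 (P * shifted_cheb (Suc n)) - shifted_cheb n" by (simp add: P_def)
  ultimately show ?case using 3
    by (simp add: pcompose_diff pcompose_smult pcompose_mult smult_diff_right mult.commute del: shifted_cheb.simps)
qed (simp add: pcompose_1)

text \<open>
  The coefficient of \<open>u\<^sup>k\<close> in the Gauss hypergeometric series with parameters \<open>- x\<close>, \<open>x\<close> and \<open>1/2\<close>. A
  real parameter \<open>x\<close> makes the symmetry under \<open>x \<mapsto> - x\<close> available.
\<close>

definition hypcoef :: "real \<Rightarrow> nat \<Rightarrow> real" where
  "hypcoef x k = pochhammer (- x) k * pochhammer x k / (pochhammer (1/2) k * fact k)"

lemma hypcoef_0: "hypcoef x 0 = 1" by (simp add: hypcoef_def)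

lemma hypcoef_Suc: "hypcoef x (Suc k) * ((1/2 + real k) * (real k + 1)) = hypcoef x k * (real k - x) * (real k + x)"
proof -
  have "pochhammer (1/2 :: real) k > 0" by (simp add: pochhammer_pos)
  then have nz: "pochhammer (1/2 :: real) k \<noteq> 0" "(1/2 + real k) \<noteq> 0" "real k + 1 \<noteq> 0" by linarith+
  then show ?thesis unfolding hypcoef_def pochhammer_Suc fact_Suc
    by (simp add: divide_simps) (simp add: algebra_simps)
qed

text \<open>
  A contiguous relation. In the product that defines the left coefficient, the factors for \<open>x + 1\<close> are
  those for \<open>x\<close> moved by one place, so only the ends of the product differ.
\<close>

lemma hypcoef_up: "hypcoef (x + 1) (Suc k) * x * ((1/2 + real k) * (real k + 1))
   = - ((x + 1) * (x + k) * (x + k + 1) * hypcoef x k)"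
proof (induction k)
  case 0
  have h: "hypcoef (x + 1) (Suc 0) = - 2 * (x + 1) * (x + 1)"
    using hypcoef_Suc[of "x + 1" 0] by (simp add: hypcoef_0 algebra_simps)
  show ?case unfolding h hypcoef_0 by (simp add: algebra_simps)
next
  case (Suc k)
  define d where "d = (1/2 + real k) * (real k + 1)"
  have d: "d \<noteq> 0" using add_pos_nonneg[of "1/2" "real k"] by (simp add: d_def)
  have "hypcoef (x + 1) (Suc (Suc k)) * x * ((1/2 + real (Suc k)) * (real (Suc k) + 1)) * d
     = (hypcoef (x + 1) (Suc k) * x * d) * (real (Suc k) - (x + 1)) * (real (Suc k) + (x + 1))"
    using hypcoef_Suc[of "x + 1" "Suc k"] by (simp only: mult_ac)
  also have "hypcoef (x + 1) (Suc k) * x * d = - ((x + 1) * (x + k) * (x + k + 1) * hypcoef x k)"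
    using Suc unfolding d_def .
  also have "\<dots> * (real (Suc k) - (x + 1)) * (real (Suc k) + (x + 1))
     = - ((x + 1) * (x + k + 1) * (x + k + 2) * (hypcoef x k * (real k - x) * (real k + x)))"
    by (simp add: algebra_simps)
  also have "\<dots> = - ((x + 1) * (x + Suc k) * (x + Suc k + 1) * hypcoef x (Suc k)) * d"
  proof -
    have h: "hypcoef x k * (real k - x) * (real k + x) = hypcoef x (Suc k) * d"
      using hypcoef_Suc[of x k] by (simp add: d_def)
    show ?thesis unfolding h by (simp add: algebra_simps)
  qed
  finally show ?case by (simp only: mult_right_cancel[OF d])
qed

lemma hypcoef_down: "hypcoef (x - 1) (Suc k) * x * ((1/2 + real k) * (real k + 1))
   = - ((x - 1) * (x - k) * (x - k - 1) * hypcoef x k)"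
proof -
  have even: "hypcoef (- z) j = hypcoef z j" for z j by (simp add: hypcoef_def mult.commute)
  have "hypcoef (x - 1) (Suc k) = hypcoef (- x + 1) (Suc k)" using even[of "x - 1"] by simp
  then show ?thesis using hypcoef_up[of "- x" k] even[of x] by (simp add: algebra_simps)
qed

text \<open>
  The Chebyshev recurrence on the level of coefficients: by the contiguous relations the coefficients of order
  \<open>k + 1\<close> at \<open>x + 1\<close> and \<open>x - 1\<close>, and the one at \<open>x\<close> too, are explicit multiples of the coefficient of order \<open>k\<close> at
  \<open>x\<close>. What remains is an identity between polynomials in \<open>x\<close> and \<open>k\<close>.
\<close>

lemma hypcoef_rec:
  assumes "x \<noteq> 0"
  shows "hypcoef (x + 1) (Suc k) = 2 * hypcoef x (Suc k) - 4 * hypcoef x k - hypcoef (x - 1) (Suc k)"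
proof -
  define d where "d = (1/2 + real k) * (real k + 1)"
  have "d > 0" by (simp add: d_def)
  have "(hypcoef (x + 1) (Suc k) + hypcoef (x - 1) (Suc k)) * x * d
      = - ((x + 1) * (x + k) * (x + k + 1) * hypcoef x k) - ((x - 1) * (x - k) * (x - k - 1) * hypcoef x k)"
    using hypcoef_up[of x k] hypcoef_down[of x k] by (simp add: d_def algebra_simps)
  also have "\<dots> = 2 * x * (hypcoef x k * (real k - x) * (real k + x)) - 4 * hypcoef x k * x * d"
    unfolding d_def by (simp add: algebra_simps)
  also have "\<dots> = 2 * x * (hypcoef x (Suc k) * d) - 4 * hypcoef x k * x * d"
    using hypcoef_Suc[of x k] by (simp add: d_def)
  finally have "(hypcoef (x + 1) (Suc k) + hypcoef (x - 1) (Suc k)) * (x * d) = (2 * hypcoef x (Suc k) - 4 * hypcoef x k) * (x * d)"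
    by (simp add: algebra_simps)
  then show ?thesis using assms \<open>d > 0\<close> by simp
qed

lemma hypcoef_eq_0: "n < k \<Longrightarrow> hypcoef (real n) k = 0"
  by (simp add: hypcoef_def pochhammer_of_nat_eq_0_iff)

lemma coeff_shifted_cheb: "coeff (shifted_cheb n) k = hypcoef (real n) k"
proof (induction n arbitrary: k rule: shifted_cheb.induct)
  case 1 show ?case using hypcoef_eq_0[of 0 k] by (cases k) (auto simp: hypcoef_0)
next
  case 2
  have "hypcoef 1 (Suc 0) = -2" using hypcoef_Suc[of 1 0] by (simp add: hypcoef_0)
  then show ?case using hypcoef_eq_0[of 1 k] by (auto simp: hypcoef_0 coeff_pCons split: nat.split)
next
  case (3 n)
  show ?case
  proof (cases k)
    case 0 then show ?thesis using 3 by (simp add: hypcoef_0)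
  next
    case (Suc j)
    have "hypcoef (real (Suc n) + 1) (Suc j) = 2 * hypcoef (real (Suc n)) (Suc j) - 4 * hypcoef (real (Suc n)) j - hypcoef (real (Suc n) - 1) (Suc j)"
      by (rule hypcoef_rec) simp
    then show ?thesis using 3 Suc by (simp add: add_ac)
  qed
qed

lemma degree_shifted_cheb: "degree (shifted_cheb n) \<le> n"
  by (rule degree_le) (simp add: coeff_shifted_cheb hypcoef_eq_0)

lemma higher_pderiv_shifted_cheb_eq_0: "(pderiv ^^ Suc n) (shifted_cheb n) = 0"
proof -
  have "degree ((pderiv ^^ n) (shifted_cheb n)) = 0" using degree_shifted_cheb[of n] by (simp add: degree_higher_pderiv)
  then show ?thesis by (simp add: pderiv_eq_0_iff)
qed

lemma higher_pderiv_reflect: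
  fixes p :: "real poly"
  assumes "pcompose p [:1, -1:] = smult s p"
  shows "pcompose ((pderiv ^^ k) p) [:1, -1:] = smult (s * (-1) ^ k) ((pderiv ^^ k) p)"
proof (induction k)
  case (Suc k)
  have "pderiv (pcompose ((pderiv ^^ k) p) [:1, -1:]) = smult (s * (-1) ^ k) ((pderiv ^^ Suc k) p)"
    by (simp add: Suc pderiv_smult)
  then have "- (pcompose ((pderiv ^^ Suc k) p) [:1, -1:]) = smult (s * (-1) ^ k) ((pderiv ^^ Suc k) p)"
    by (simp add: pderiv_pcompose pderiv_pCons)
  then show ?case by (simp add: minus_equation_iff[of "pcompose _ _"])
qed (use assms in simp)

text \<open>
  The derivative of order \<open>k\<close> is odd about \<open>1/2\<close> whenever \<open>n + k\<close> is odd.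
\<close>

lemma higher_pderiv_shifted_cheb_half:
  assumes "odd (n + k)" shows "poly ((pderiv ^^ k) (shifted_cheb n)) (1 / 2) = 0"
proof -
  have "poly (pcompose ((pderiv ^^ k) (shifted_cheb n)) [:1, -1:]) (1/2) = - poly ((pderiv ^^ k) (shifted_cheb n)) (1/2)"
    using assms by (simp add: higher_pderiv_reflect[OF shifted_cheb_reflect] flip: power_add)
  then show ?thesis by (simp add: poly_pcompose)
qed

text \<open>
  The operator \<open>(1 - w d/du)\<^sup>-\<^sup>1\<close> applied to the polynomial, as a Neumann series; the series ends
  because the polynomial has degree at most \<open>n\<close>.
\<close>

definition cheb_resolvent :: "nat \<Rightarrow> complex \<Rightarrow> real \<Rightarrow> complex" where
  "cheb_resolvent n w u = (\<Sum>k\<le>n. w ^ k * of_real (poly ((pderiv ^^ k) (shifted_cheb n)) u))"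

lemma cheb_resolvent_0: "cheb_resolvent n w 0 = hyp3F1 n w"
proof -
  have "poly ((pderiv ^^ k) (shifted_cheb n)) 0 = fact k * hypcoef (real n) k" for k
    by (simp add: poly_0_coeff_0 coeff_higher_pderiv coeff_shifted_cheb pochhammer_fact)
  moreover have "complex_of_real (fact k * hypcoef (real n) k) = pochhammer (- of_nat n) k * pochhammer (of_nat n) k * pochhammer 1 k
                / (pochhammer (1/2) k * fact k)" for k
    by (simp add: hypcoef_def pochhammer_of_real[symmetric] pochhammer_fact[symmetric])
  ultimately show ?thesis by (simp add: cheb_resolvent_def hyp3F1_def atMost_atLeast0 mult.commute)
qed

lemma cheb_resolvent_deriv:
  "\<exists>D. (cheb_resolvent n w has_vector_derivative D) (at u) \<and> cheb_resolvent n w u - w * D = of_real (poly (shifted_cheb n) u)"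
proof (intro exI conjI)
  let ?p = "\<lambda>k. of_real (poly ((pderiv ^^ k) (shifted_cheb n)) u) :: complex"
  have d: "((\<lambda>u. complex_of_real (poly p u)) has_vector_derivative of_real (poly (pderiv p) u)) (at u)" for p
    by (intro has_vector_derivative_of_real) (simp add: poly_DERIV has_real_derivative_iff_has_vector_derivative[symmetric])
  show "(cheb_resolvent n w has_vector_derivative (\<Sum>k\<le>n. w ^ k * ?p (Suc k))) (at u)"
    unfolding cheb_resolvent_def[abs_def] funpow.simps o_def
    by (intro has_vector_derivative_sum has_vector_derivative_mult_right d)
  have "(\<Sum>k\<le>n. w ^ k * ?p k) - w * (\<Sum>k\<le>n. w ^ k * ?p (Suc k)) = (\<Sum>k\<le>n. w ^ k * ?p k - w ^ Suc k * ?p (Suc k))"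
    by (simp add: sum_subtractf sum_distrib_left mult.assoc)
  also have "\<dots> = w ^ 0 * ?p 0 - w ^ Suc n * ?p (Suc n)"
    by (rule sum_telescope)
  finally show "cheb_resolvent n w u - w * (\<Sum>k\<le>n. w ^ k * ?p (Suc k)) = of_real (poly (shifted_cheb n) u)"
    unfolding cheb_resolvent_def higher_pderiv_shifted_cheb_eq_0 by simp
qed

text \<open>
  By parity only the terms with \<open>k\<close> of the same parity as \<open>n\<close> survive at \<open>1/2\<close>, and for these the power
  of the imaginary number \<open>i r\<close> is real or imaginary along with \<open>n\<close>.
\<close>

lemma cheb_resolvent_half:
  fixes r :: real
  shows "even n \<Longrightarrow> Im (cheb_resolvent n (\<i> * of_real r) (1 / 2)) = 0"
    and "odd n \<Longrightarrow> Re (cheb_resolvent n (\<i> * of_real r) (1 / 2)) = 0"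
proof -
  let ?p = "\<lambda>k. poly ((pderiv ^^ k) (shifted_cheb n)) (1 / 2)"
  have ev: "(\<i> * complex_of_real r) ^ (2 * m) = of_real ((- (r\<^sup>2)) ^ m)" for m
    by (simp add: power_mult power_mult_distrib)
  have "Im ((\<i> * of_real r) ^ k * of_real (?p k)) = 0" if "even n" for k
  proof (cases "even k")
    case True then obtain m where "k = 2 * m" by (elim evenE)
    then show ?thesis by (simp only: ev) simp
  next
    case False then show ?thesis using higher_pderiv_shifted_cheb_half[of n k] that by simp
  qed
  then show "even n \<Longrightarrow> Im (cheb_resolvent n (\<i> * of_real r) (1 / 2)) = 0" by (auto simp only: cheb_resolvent_def Im_sum intro!: sum.neutral)
  have "Re ((\<i> * of_real r) ^ k * of_real (?p k)) = 0" if "odd n" for k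
  proof (cases "even k")
    case False then obtain m where "k = 2 * m + 1" by (elim oddE)
    then show ?thesis by (simp only: ev power_add) simp
  next
    case True then show ?thesis using higher_pderiv_shifted_cheb_half[of n k] that by simp
  qed
  then show "odd n \<Longrightarrow> Re (cheb_resolvent n (\<i> * of_real r) (1 / 2)) = 0" by (auto simp only: cheb_resolvent_def Re_sum intro!: sum.neutral)
qed

section \<open>From the hypergeometric sum to an oscillatory integral\<close>

text \<open>
  With \<open>u = (sin (\<theta> / 2))\<^sup>2\<close> the function \<open>cis (- l cos \<theta>) Q (u)\<close> has derivative
  \<open>i l sin \<theta> cis (- l cos \<theta>) cos (n \<theta>)\<close>, because \<open>Q - w Q' = U\<close> and \<open>U (u) = cos (n \<theta>)\<close>. Subtracting
  \<open>cis (- l cos \<theta>) cos (n \<theta>)\<close> builds the integration by parts into the antiderivative: the two terms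
  with the factor \<open>l sin \<theta>\<close> cancel, and \<open>n sin (n \<theta>)\<close> times the exponential remains.
\<close>

lemma G_integral:
  assumes "n \<ge> 1" "y \<noteq> 0"
  defines "l \<equiv> real n / y"
  shows "((\<lambda>\<theta>. of_real (n * sin (n * \<theta>)) * cis (- l * cos \<theta>)) has_integral
      cheb_resolvent n (\<i> * of_real (y / (2 * n))) (1 / 2) - of_real (cos (n * (pi / 2))) - G n y + cis (- l)) {0..pi/2}"
proof -
  define w where "w = \<i> * of_real (y / (2 * n))"
  define u where "u = (\<lambda>\<theta>::real. (sin (\<theta> / 2))\<^sup>2)"
  define H where "H = (\<lambda>\<theta>::real. cis (- l * cos \<theta>) * (cheb_resolvent n w (u \<theta>) - of_real (cos (n * \<theta>))))"
  have H': "(H has_vector_derivative of_real (n * sin (n * \<theta>)) * cis (- l * cos \<theta>)) (at \<theta>)" for \<theta> :: real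
  proof -
    obtain D where D: "(cheb_resolvent n w has_vector_derivative D) (at (u \<theta>))"
      and wD: "cheb_resolvent n w (u \<theta>) - w * D = of_real (cos (n * \<theta>))"
      using cheb_resolvent_deriv[of n w "u \<theta>"] shifted_cheb_cos[of n \<theta>] by (auto simp: u_def)
    have u: "(u has_real_derivative sin \<theta> / 2) (at \<theta>)"
      unfolding u_def using sin_double[of "\<theta> / 2"]
      by (auto intro!: derivative_eq_intros)
    have d1: "((\<lambda>\<theta>. cheb_resolvent n w (u \<theta>)) has_vector_derivative (sin \<theta> / 2) *\<^sub>R D) (at \<theta>)"
      using vector_diff_chain_at[OF u[unfolded has_real_derivative_iff_has_vector_derivative] D] by (simp add: o_def)
    have d2: "((\<lambda>\<theta>. complex_of_real (cos (n * \<theta>))) has_vector_derivative of_real (- real n * sin (n * \<theta>))) (at \<theta>)"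
    proof -
      have "((\<lambda>\<theta>. cos (n * \<theta>)) has_real_derivative - real n * sin (n * \<theta>)) (at \<theta>)"
        by (auto intro!: derivative_eq_intros)
      then show ?thesis by (rule has_vector_derivative_of_real)
    qed
    have d3: "((\<lambda>\<theta>. cis (- l * cos \<theta>)) has_vector_derivative (l * sin \<theta>) *\<^sub>R (\<i> * cis (- l * cos \<theta>))) (at \<theta>)"
      unfolding has_vector_derivative_def
      by (rule derivative_eq_intros refl)+ (auto simp: fun_eq_iff scaleR_conv_of_real)
    have lw: "\<i> * of_real l * w = - 1 / 2"
      using assms(1,2) by (simp add: w_def l_def field_simps)
    have "cis (- l * cos \<theta>) * ((sin \<theta> / 2) *\<^sub>R D - of_real (- real n * sin (n * \<theta>))) + (l * sin \<theta>) *\<^sub>R (\<i> * cis (- l * cos \<theta>)) * (cheb_resolvent n w (u \<theta>) - of_real (cos (n * \<theta>)))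
       = cis (- l * cos \<theta>) * (of_real (n * sin (n * \<theta>)) + of_real (sin \<theta>) * (D / 2 + (\<i> * of_real l * w) * D))"
      unfolding wD[symmetric] by (simp add: scaleR_conv_of_real algebra_simps)
    also have "\<dots> = of_real (n * sin (n * \<theta>)) * cis (- l * cos \<theta>)"
      unfolding lw by (simp add: algebra_simps)
    finally show ?thesis
      unfolding H_def using has_vector_derivative_mult[OF d3 has_vector_derivative_diff[OF d1 d2]] by simp
  qed
  have "((\<lambda>\<theta>. of_real (n * sin (n * \<theta>)) * cis (- l * cos \<theta>)) has_integral H (pi / 2) - H 0) {0..pi/2}"
    by (intro fundamental_theorem_of_calculus has_vector_derivative_at_within[OF H']) simp
  moreover have "H 0 = G n y - cis (- l)"
  proof -
    have "cis (- l) = exp (- \<i> * of_nat n / of_real y)" by (simp add: cis_conv_exp l_def)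
    moreover have "w = \<i> * of_real y / (2 * of_nat n)" by (simp add: w_def)
    ultimately show ?thesis by (simp add: H_def u_def cheb_resolvent_0 G_def algebra_simps)
  qed
  moreover have "H (pi / 2) = cheb_resolvent n w (1 / 2) - of_real (cos (n * (pi / 2)))"
  proof -
    have u: "u (pi / 2) = 1 / 2" by (simp add: u_def sin_45 power_divide)
    show ?thesis unfolding H_def u by simp
  qed
  ultimately show ?thesis unfolding w_def by (simp add: algebra_simps)
qed

definition phase_integral :: "real \<Rightarrow> nat \<Rightarrow> complex" where
  "phase_integral y n = integral {0..pi/2} (\<lambda>\<theta>. cis (real n * (\<theta> + cos \<theta> / y)))"

lemma nonstationary_bound:
  assumes "n \<ge> 1" "y > 0"
  shows "norm (integral {0..pi/2} (\<lambda>\<theta>. cis (real n * (\<theta> - cos \<theta> / y)))) \<le> 2 / real n"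
proof -
  have "norm (integral {0..pi/2} (\<lambda>\<theta>. cis (real n * (\<theta> - cos \<theta> / y)))) \<le> 2 / (real n * (1 + sin 0 / y))"
  proof (rule van_der_corput_convex[where q'' = "\<lambda>\<theta>. real n * (cos \<theta> / y)"])
    show "continuous_on {0..pi/2} (\<lambda>\<theta>. real n * (cos \<theta> / y))"
      using assms by (intro continuous_intros) auto
    fix x assume x: "x \<in> {0..pi/2}"
    show "((\<lambda>\<theta>. real n * (\<theta> - cos \<theta> / y)) has_real_derivative real n * (1 + sin x / y)) (at x within {0..pi/2})"
      "((\<lambda>\<theta>. real n * (1 + sin \<theta> / y)) has_real_derivative real n * (cos x / y)) (at x within {0..pi/2})"
      using assms by (auto intro!: derivative_eq_intros)
    show "0 \<le> real n * (cos x / y)"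
      using assms x by (auto intro!: mult_nonneg_nonneg divide_nonneg_pos cos_ge_zero)
  qed (use assms in auto)
  then show ?thesis by simp
qed

text \<open>
  The constant \<open>3\<close> collects three terms of absolute value at most one: the boundary terms \<open>cis (- l)\<close> and
  \<open>cos (n pi / 2)\<close>, and the contribution of the phase \<open>n (\<theta> - cos \<theta> / y)\<close> without stationary
  point. The value of the resolvent at \<open>1/2\<close> drops out by parity.
\<close>

lemma G_phase_integral:
  assumes "n \<ge> 1" "y > 0"
  shows "even n \<Longrightarrow> \<bar>Im (G n y) + real n / 2 * Re (phase_integral y n)\<bar> \<le> 3"
    and "odd n \<Longrightarrow> \<bar>Re (G n y) + real n / 2 * Im (phase_integral y n)\<bar> \<le> 3"
proof -
  define N where "N = integral {0..pi/2} (\<lambda>\<theta>. cis (real n * (\<theta> - cos \<theta> / y)))"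
  define M where "M = phase_integral y n"
  define K where "K = cheb_resolvent n (\<i> * of_real (y / (2 * n))) (1 / 2)"
  define l where "l = real n / y"
  define C where "C = cos (n * (pi / 2))"
  have hN: "((\<lambda>\<theta>. cis (real n * (\<theta> - cos \<theta> / y))) has_integral N) {0..pi/2}"
    unfolding N_def using assms by (intro integrable_integral integrable_continuous_real continuous_intros) auto
  have hM: "((\<lambda>\<theta>. cis (real n * (\<theta> + cos \<theta> / y))) has_integral M) {0..pi/2}"
    unfolding M_def phase_integral_def using assms by (intro integrable_integral integrable_continuous_real continuous_intros) auto
  have "((\<lambda>\<theta>. cnj (cis (real n * (\<theta> + cos \<theta> / y)))) has_integral cnj M) {0..pi/2}"
    using has_integral_linear[OF hM bounded_linear_cnj] by (simp add: o_def)
  from has_integral_mult_right[OF has_integral_diff[OF hN this], of "- \<i> * of_nat n / 2"]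
  have 1: "((\<lambda>\<theta>. - \<i> * of_nat n / 2 * (cis (real n * (\<theta> - cos \<theta> / y)) - cnj (cis (real n * (\<theta> + cos \<theta> / y)))))
      has_integral - \<i> * of_nat n / 2 * (N - cnj M)) {0..pi/2}" .
  have 2: "- \<i> * of_nat n / 2 * (cis (real n * (\<theta> - cos \<theta> / y)) - cnj (cis (real n * (\<theta> + cos \<theta> / y))))
      = of_real (n * sin (n * \<theta>)) * cis (- l * cos \<theta>)" for \<theta> :: real
  proof -
    have "cis (real n * (\<theta> - cos \<theta> / y)) = cis (n * \<theta>) * cis (- l * cos \<theta>)"
         "cnj (cis (real n * (\<theta> + cos \<theta> / y))) = cis (- (n * \<theta>)) * cis (- l * cos \<theta>)"
      by (simp_all add: cis_mult cis_cnj l_def algebra_simps)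
    moreover have "cis (n * \<theta>) - cis (- (n * \<theta>)) = 2 * \<i> * of_real (sin (n * \<theta>))"
      by (simp add: complex_eq_iff)
    ultimately show ?thesis by (simp add: mult_ac flip: left_diff_distrib)
  qed
  have "- \<i> * of_nat n / 2 * (N - cnj M) = K - of_real C - G n y + cis (- l)"
    using has_integral_unique[OF 1[unfolded 2] G_integral[OF assms(1), of y, folded l_def C_def]] assms by (simp add: K_def)
  then have G: "G n y = K - of_real C + cis (- l) + \<i> * of_nat n / 2 * (N - cnj M)"
    by (simp add: algebra_simps)
  have nN: "real n / 2 * norm N \<le> 1"
    using nonstationary_bound[OF assms] assms(1) unfolding N_def by (simp add: field_simps)
  have "\<bar>real n / 2 * Re N\<bar> \<le> real n / 2 * norm N" "\<bar>real n / 2 * Im N\<bar> \<le> real n / 2 * norm N"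
    using abs_Re_le_cmod[of N] abs_Im_le_cmod[of N] by (simp_all add: abs_mult mult_left_mono)
  with nN have N: "\<bar>real n / 2 * Re N\<bar> \<le> 1" "\<bar>real n / 2 * Im N\<bar> \<le> 1" by linarith+
  have C: "\<bar>C\<bar> \<le> 1" by (simp add: C_def)
  have S: "\<bar>sin l\<bar> \<le> 1" "\<bar>cos l\<bar> \<le> 1" by simp_all
  show "\<bar>Im (G n y) + real n / 2 * Re M\<bar> \<le> 3" if "even n"
  proof -
    have "Im K = 0" unfolding K_def by (rule cheb_resolvent_half(1)[OF that])
    then have "Im (G n y) + real n / 2 * Re M = - sin l + real n / 2 * Re N"
      by (simp add: G field_simps)
    then show ?thesis using N S by linarith
  qed
  show "\<bar>Re (G n y) + real n / 2 * Im M\<bar> \<le> 3" if "odd n"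
  proof -
    have "Re K = 0" unfolding K_def by (rule cheb_resolvent_half(2)[OF that])
    then have "Re (G n y) + real n / 2 * Im M = - C + cos l - real n / 2 * Im N"
      by (simp add: G field_simps)
    then show ?thesis using N S C by linarith
  qed
qed

section \<open>Asymptotics of the oscillatory integral\<close>

text \<open>
  At the stationary point \<open>a = arcsin y\<close> the phase \<open>\<theta> + cos \<theta> / y\<close> has its maximum \<open>A\<close>. Measured downwards from
  \<open>A\<close>, it gives on each side of \<open>a\<close> a convex function with second derivative \<open>cos a / y = 2 k\<close> at \<open>a\<close>, so both sides
  contribute equally. As the phase is a maximum, the conjugate of the Fresnel value appears, whence the shift by \<open>- pi / 4\<close>.
\<close>

lemma phase_integral_tendsto:
  fixes y :: real
  assumes "0 < y" "y < 1"
  shows "(\<lambda>n. sqrt (real n) *\<^sub>R phase_integral y n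
     - of_real (sqrt (2 * pi * y / sqrt (1 - y\<^sup>2))) * cis (phase y n)) \<longlonglongrightarrow> 0"
proof -
  define a where "a = arcsin y"
  define A where "A = a + cos a / y"
  define k where "k = cos a / (2 * y)"
  define L where "L = (of_real (sqrt pi / 2) * cis (pi / 4)) /\<^sub>R sqrt k"
  have a: "0 < a" "a < pi / 2" using arcsin_less_mono[of 0 y] arcsin_less_arcsin[of 0 y] arcsin_less_arcsin[of y 1] assms by (auto simp: a_def)
  have sin_a: "sin a = y" using assms by (simp add: a_def)
  have cos_a: "cos a = sqrt (1 - y\<^sup>2)" using assms by (simp add: a_def cos_arcsin)
  have "cos a > 0" using a by (intro cos_gt_zero_pi) auto
  then have "k > 0" using assms by (simp add: k_def)
  define J1 where "J1 = (\<lambda>n. integral {0..pi/2 - a} (\<lambda>t. cis (real n * (A - ((a + t) + cos (a + t) / y)))))"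
  define J2 where "J2 = (\<lambda>n. integral {0..a} (\<lambda>t. cis (real n * (A - ((a - t) + cos (a - t) / y)))))"
  have "(\<lambda>n. sqrt (real n) *\<^sub>R J1 n) \<longlonglongrightarrow> L"
    unfolding J1_def L_def
  proof (rule stationary_phase_endpoint)
    fix t assume t: "t \<in> {0..pi/2 - a}"
    show "((\<lambda>t. A - ((a + t) + cos (a + t) / y)) has_real_derivative (sin (a + t) / y - 1)) (at t within {0..pi/2 - a})"
      "((\<lambda>t. sin (a + t) / y - 1) has_real_derivative cos (a + t) / y) (at t within {0..pi/2 - a})"
      using assms by (auto intro!: derivative_eq_intros)
    show "0 \<le> cos (a + t) / y" using a t assms by (intro divide_nonneg_pos cos_ge_zero) auto
  qed (use a assms \<open>k > 0\<close> in \<open>auto simp: A_def k_def sin_a intro!: continuous_intros\<close>)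
  moreover have "(\<lambda>n. sqrt (real n) *\<^sub>R J2 n) \<longlonglongrightarrow> L"
    unfolding J2_def L_def
  proof (rule stationary_phase_endpoint)
    fix t assume t: "t \<in> {0..a}"
    show "((\<lambda>t. A - ((a - t) + cos (a - t) / y)) has_real_derivative (1 - sin (a - t) / y)) (at t within {0..a})"
      "((\<lambda>t. 1 - sin (a - t) / y) has_real_derivative cos (a - t) / y) (at t within {0..a})"
      using assms by (auto intro!: derivative_eq_intros)
    show "0 \<le> cos (a - t) / y" using a t assms by (intro divide_nonneg_pos cos_ge_zero) auto
  qed (use a assms \<open>k > 0\<close> in \<open>auto simp: A_def k_def sin_a intro!: continuous_intros\<close>)
  ultimately have "(\<lambda>n. norm (sqrt (real n) *\<^sub>R J1 n + sqrt (real n) *\<^sub>R J2 n - (L + L))) \<longlonglongrightarrow> 0"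
    by (intro tendsto_norm_zero LIM_zero tendsto_add)
  moreover have "norm (sqrt (real n) *\<^sub>R J1 n + sqrt (real n) *\<^sub>R J2 n - (L + L)) =
     norm (sqrt (real n) *\<^sub>R phase_integral y n - of_real (sqrt (2 * pi * y / sqrt (1 - y\<^sup>2))) * cis (phase y n))" for n
  proof -
    define f where "f = (\<lambda>\<theta>. cis (real n * (\<theta> + cos \<theta> / y)))"
    have int: "f integrable_on {u..v}" for u v
      unfolding f_def using assms by (intro integrable_continuous_real continuous_intros) auto
    have J1: "cis (n * A) * cnj (J1 n) = integral {a..pi/2} f"
    proof -
      have "cis (n * A) * cnj (J1 n) = integral {0..pi/2 - a} (\<lambda>t. cis (n * A) * cnj (cis (real n * (A - ((a + t) + cos (a + t) / y)))))"
        unfolding J1_def integral_cnj by simp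
      also have "\<dots> = integral {0..pi/2 - a} (f \<circ> (+) a)"
        by (intro integral_cong) (simp add: f_def cis_cnj cis_mult algebra_simps)
      also have "\<dots> = integral {a..pi/2} f"
        unfolding integral_shift_Icc_real by simp
      finally show ?thesis .
    qed
    have J2: "cis (n * A) * cnj (J2 n) = integral {0..a} f"
    proof -
      have "cis (n * A) * cnj (J2 n) = integral {0..a} (\<lambda>t. cis (n * A) * cnj (cis (real n * (A - ((a - t) + cos (a - t) / y)))))"
        unfolding J2_def integral_cnj by simp
      also have "\<dots> = integral {0..a} (\<lambda>t. (f \<circ> (+) a) (- t))"
        by (intro integral_cong) (simp add: f_def cis_cnj cis_mult algebra_simps)
      also have "\<dots> = integral {- a..0} (f \<circ> (+) a)"
        using Henstock_Kurzweil_Integration.integral_reflect_real[where a = "- a" and b = 0 and f = "f \<circ> (+) a"] by simp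
      also have "\<dots> = integral {0..a} f"
        unfolding integral_shift_Icc_real by simp
      finally show ?thesis .
    qed
    have "integral {0..a} f + integral {a..pi/2} f = phase_integral y n"
      unfolding phase_integral_def f_def[symmetric]
      by (rule Henstock_Kurzweil_Integration.integral_combine) (use a int in auto)
    then have M: "phase_integral y n = cis (n * A) * cnj (J1 n + J2 n)"
      unfolding J1[symmetric] J2[symmetric] by (simp add: algebra_simps)
    have ph: "phase y n = n * A - pi / 4"
      by (simp add: phase_def A_def cos_a a_def[symmetric] add.commute)
    have "sqrt (2 * pi * y / sqrt (1 - y\<^sup>2)) = sqrt pi / sqrt k"
      by (simp add: k_def cos_a real_sqrt_divide[symmetric] mult_ac)
    moreover have "cis (phase y n) = cis (n * A) * cis (- (pi / 4))"
      by (simp add: ph cis_mult)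
    ultimately have "cis (n * A) * cnj (L + L) = of_real (sqrt (2 * pi * y / sqrt (1 - y\<^sup>2))) * cis (phase y n)"
      by (simp add: L_def cis_cnj scaleR_conv_of_real field_simps)
    then have "sqrt (real n) *\<^sub>R phase_integral y n - of_real (sqrt (2 * pi * y / sqrt (1 - y\<^sup>2))) * cis (phase y n)
      = cis (n * A) * cnj (sqrt (real n) *\<^sub>R J1 n + sqrt (real n) *\<^sub>R J2 n - (L + L))"
      unfolding M by (simp add: algebra_simps scaleR_conv_of_real)
    then show ?thesis by (simp only: norm_mult norm_cis complex_mod_cnj mult_1)
  qed
  ultimately show ?thesis by (simp only: tendsto_norm_zero_iff)
qed

lemma osc_equivI:
  assumes "(e \<longlongrightarrow> 0) at_top" "S = {n::nat. P n}"
    and "\<And>n. n \<ge> 1 \<Longrightarrow> P n \<Longrightarrow> \<bar>f n - g n\<bar> \<le> C + sqrt n * e n"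
  shows "osc_equiv (inf at_top (principal S)) f g"
  unfolding osc_equiv_def
proof (rule smalloI_tendsto)
  have "\<forall>\<^sub>F n :: nat in at_top. n \<ge> 1" by (rule eventually_ge_at_top)
  then have ev: "\<forall>\<^sub>F n in inf at_top (principal S). n \<ge> 1 \<and> P n"
    unfolding eventually_inf_principal assms(2) by eventually_elim auto
  then show "\<forall>\<^sub>F n in inf at_top (principal S). sqrt (real n) \<noteq> 0" by eventually_elim auto
  have "(\<lambda>n. C / sqrt (real n)) \<longlonglongrightarrow> 0" by real_asymp
  then have "((\<lambda>n. C / sqrt (real n) + e n) \<longlongrightarrow> 0) at_top"
    using tendsto_add[OF _ assms(1)] by fastforce
  then have "((\<lambda>n. C / sqrt (real n) + e n) \<longlongrightarrow> 0) (inf at_top (principal S))"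
    by (rule tendsto_mono[rotated]) simp
  then show "((\<lambda>n. (f n - g n) / sqrt (real n)) \<longlongrightarrow> 0) (inf at_top (principal S))"
  proof (rule Lim_null_comparison[rotated])
    show "\<forall>\<^sub>F n in inf at_top (principal S). norm ((f n - g n) / sqrt (real n)) \<le> C / sqrt (real n) + e n"
      using ev
    proof eventually_elim
      case (elim n)
      then have "\<bar>f n - g n\<bar> / sqrt n \<le> (C + sqrt n * e n) / sqrt n"
        using assms(3) by (intro divide_right_mono) auto
      then show ?case using elim by (simp add: add_divide_distrib)
    qed
  qed
qed

lemma G_uminus: "G n y = cnj (G n (- y))"
proof -
  have "cnj (pochhammer z k) = pochhammer (cnj z) k" for z k
    by (simp add: pochhammer_prod)
  then show ?thesis by (simp add: G_def hyp3F1_def exp_cnj)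
qed

theorem theorem1:
  shows "(\<forall>y::real. 0 < y \<and> y < 1 \<longrightarrow>
            osc_equiv even_at_top (\<lambda>n. Im (G n y)) (\<lambda>n. - (amplitude y n * cos (phase y n))) \<and>
            osc_equiv odd_at_top (\<lambda>n. Re (G n y)) (\<lambda>n. - (amplitude y n * sin (phase y n)))) \<and>
         (\<forall>y::real. - 1 < y \<and> y < 0 \<longrightarrow> (\<forall>n\<ge>1. G n y = cnj (G n (- y))))"
proof (intro conjI allI impI)
  fix y :: real assume "0 < y \<and> y < 1"
  then have y: "0 < y" "y < 1" by auto
  define B where "B = sqrt (2 * pi * y / sqrt (1 - y\<^sup>2))"
  define E where "E = (\<lambda>n. sqrt (real n) *\<^sub>R phase_integral y n - of_real B * cis (phase y n))"
  have E: "(\<lambda>n. norm (E n) / 2) \<longlonglongrightarrow> 0"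
    using tendsto_divide[OF tendsto_norm_zero[OF phase_integral_tendsto[OF y]] tendsto_const[of 2]]
    by (simp add: E_def B_def)
  \<comment> \<open>\<open>n / 2\<close> times the main term \<open>B / sqrt n\<close> of the phase integral is exactly the amplitude.\<close>
  have amp: "amplitude y n = sqrt n * (B / 2)" for n
  proof -
    have "real n * pi * y / (2 * sqrt (1 - y\<^sup>2)) = n * (2 * pi * y / sqrt (1 - y\<^sup>2)) / 2\<^sup>2"
      by simp
    then show ?thesis unfolding amplitude_def B_def by (simp only: real_sqrt_divide real_sqrt_mult) simp
  qed
  have M: "real n / 2 * Re (phase_integral y n) = amplitude y n * cos (phase y n) + sqrt n * (Re (E n) / 2)"
          "real n / 2 * Im (phase_integral y n) = amplitude y n * sin (phase y n) + sqrt n * (Im (E n) / 2)" for n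
  proof -
    have "sqrt n * (sqrt n * x) = n * x" for x by (simp flip: mult.assoc)
    moreover have "Re (E n) = sqrt n * Re (phase_integral y n) - B * cos (phase y n)"
                  "Im (E n) = sqrt n * Im (phase_integral y n) - B * sin (phase y n)"
      by (simp_all add: E_def)
    ultimately show "real n / 2 * Re (phase_integral y n) = amplitude y n * cos (phase y n) + sqrt n * (Re (E n) / 2)"
        "real n / 2 * Im (phase_integral y n) = amplitude y n * sin (phase y n) + sqrt n * (Im (E n) / 2)"
      by (simp_all add: amp right_diff_distrib diff_divide_distrib)
  qed
  have bound: "\<bar>sqrt n * (Re (E n) / 2)\<bar> \<le> sqrt n * (norm (E n) / 2)"
              "\<bar>sqrt n * (Im (E n) / 2)\<bar> \<le> sqrt n * (norm (E n) / 2)" for n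
    using abs_Re_le_cmod[of "E n"] abs_Im_le_cmod[of "E n"] by (auto simp: abs_mult intro!: mult_left_mono)
  show "osc_equiv even_at_top (\<lambda>n. Im (G n y)) (\<lambda>n. - (amplitude y n * cos (phase y n)))"
    unfolding even_at_top_def
  proof (rule osc_equivI[OF E refl])
    fix n :: nat assume "n \<ge> 1" "even n"
    then show "\<bar>Im (G n y) - - (amplitude y n * cos (phase y n))\<bar> \<le> 3 + sqrt n * (norm (E n) / 2)"
      using G_phase_integral(1)[OF _ y(1), of n] M(1)[of n] bound(1)[of n] by linarith
  qed
  show "osc_equiv odd_at_top (\<lambda>n. Re (G n y)) (\<lambda>n. - (amplitude y n * sin (phase y n)))"
    unfolding odd_at_top_def
  proof (rule osc_equivI[OF E refl])
    fix n :: nat assume "n \<ge> 1" "odd n"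
    then show "\<bar>Re (G n y) - - (amplitude y n * sin (phase y n))\<bar> \<le> 3 + sqrt n * (norm (E n) / 2)"
      using G_phase_integral(2)[OF _ y(1), of n] M(2)[of n] bound(2)[of n] by linarith
  qed
qed (rule G_uminus)

end
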